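(* Let $H_A,H_B$ be Hilbert spaces of the same finite dimension $n$ with orthonormal bases $\{|i\rangle_A\}_{i=1}^n$, $\{|i\rangle_B\}_{i=1}^n$, let $H_E$ be a finite-dimensional Hilbert space with a fixed unit vector $|0\rangle_E$, let $U_{BE}$ be a unitary on $H_B\otimes H_E$, and put $U_{ABE}=I_A\otimes U_{BE}$. Define the channel $\Phi_B$ and its complementary channel $\Phi_E$ on operators $\rho_B$ on $H_B$ by $$\Phi_B(\rho_B)=\mathrm{tr}_E\big[U_{BE}(\rho_B\otimes|0\rangle_E\langle0|)U_{BE}^*\big],\qquad\Phi_E(\rho_B)=\mathrm{tr}_B\big[U_{BE}(\rho_B\otimes|0\rangle_E\langle0|)U_{BE}^*\big].$$ Let $|\psi_M\rangle_{AB}=\sum_{i=1}^n|i\rangle_A|i\rangle_B$. If the output state $U_{ABE}|\psi_M\rangle_{AB}|0\rangle_E$ is $E\to B$ degradable, then the channel $\Phi_B$ is anti-degradable with respect to $\Phi_E$, i.e. there exists a quantum channel $\hat T$ from operators on $H_E$ to operators on $H_B$ such that $\hat T\circ\Phi_E=\Phi_B$.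
   Context: $\mathrm{tr}_A,\mathrm{tr}_B,\mathrm{tr}_E$ denote partial traces over the corresponding factors. A quantum channel is a trace-preserving completely positive linear map. A (not necessarily normalized) vector $|\tilde\psi\rangle\in H_A\otimes H_B\otimes H_E$ is called $E\to B$ degradable if there is a map $T(X)=\sum_{j=1}^r(I_A\otimes F_j)X(I_A\otimes F_j)^*$ with $F_j:H_E\to H_B$ and $\sum_{j=1}^rF_j^*F_j=I_E$ such that $T(\mathrm{tr}_B|\tilde\psi\rangle\langle\tilde\psi|)=\mathrm{tr}_E|\tilde\psi\rangle\langle\tilde\psi|$. *)

theory Defs
  imports "HOL-Analysis.Analysis"
begin

text \<open>
  A Hilbert space of finite dimension \<open>n\<close> is \<^typ>\<open>complex^'n\<close> with \<open>CARD('n) = n\<close>; a linear map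
  from \<^typ>\<open>complex^'m\<close> to \<^typ>\<open>complex^'n\<close> is a matrix of type \<^typ>\<open>complex^'m^'n\<close>; tensor products
  are indexed by product types.
\<close>

definition cdot :: "complex^'n \<Rightarrow> complex^'n \<Rightarrow> complex" where
  "cdot u v = (\<Sum>i\<in>UNIV. cnj (u $ i) * v $ i)"

text \<open>Spanning is automatic: the family has as many members as the dimension of the space.\<close>

definition orthonormal_basis :: "('n \<Rightarrow> complex^'n) \<Rightarrow> bool" where
  "orthonormal_basis b \<longleftrightarrow> (\<forall>i j. cdot (b i) (b j) = (if i = j then 1 else 0))"

definition adj :: "complex^'m^'n \<Rightarrow> complex^'n^'m" where
  "adj A = map_matrix cnj (transpose A)"

definition unitary :: "complex^'n^'n \<Rightarrow> bool" where
  "unitary U \<longleftrightarrow> U ** adj U = mat 1 \<and> adj U ** U = mat 1"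

definition ketbra :: "complex^'m \<Rightarrow> complex^'n \<Rightarrow> complex^'n^'m" where
  "ketbra u v = (\<chi> i j. u $ i * cnj (v $ j))"

definition tensor_vec :: "complex^'m \<Rightarrow> complex^'n \<Rightarrow> complex^('m \<times> 'n)" (infixr "\<otimes>\<^sub>v" 75) where
  "u \<otimes>\<^sub>v v = (\<chi> p. u $ fst p * v $ snd p)"

definition tensor_mat ::
    "complex^'m^'n \<Rightarrow> complex^'p^'q \<Rightarrow> complex^('m \<times> 'p)^('n \<times> 'q)" (infixr "\<otimes>\<^sub>m" 75) where
  "A \<otimes>\<^sub>m B = (\<chi> p q. A $ fst p $ fst q * B $ snd p $ snd q)"

text \<open>The canonical identification of \<open>(H\<^sub>A \<otimes> H\<^sub>B) \<otimes> H\<^sub>E\<close> with \<open>H\<^sub>A \<otimes> (H\<^sub>B \<otimes> H\<^sub>E)\<close>; the latter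
  represents the tripartite space below.\<close>

definition assoc_vec ::
    "complex^(('a::finite \<times> 'b::finite) \<times> 'e::finite) \<Rightarrow> complex^('a \<times> 'b \<times> 'e)" where
  "assoc_vec v = (\<chi> p. v $ ((fst p, fst (snd p)), snd (snd p)))"

text \<open>The suffix of a partial trace names the factor that is traced out, not the one that remains.\<close>

definition BE_tr_E :: "complex^('b::finite \<times> 'e::finite)^('b \<times> 'e) \<Rightarrow> complex^'b^'b" where
  "BE_tr_E X = (\<chi> i j. \<Sum>k\<in>UNIV. X $ (i, k) $ (j, k))"

definition BE_tr_B :: "complex^('b::finite \<times> 'e::finite)^('b \<times> 'e) \<Rightarrow> complex^'e^'e" where
  "BE_tr_B X = (\<chi> k l. \<Sum>i\<in>UNIV. X $ (i, k) $ (i, l))"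

definition ABE_tr_E ::
    "complex^('a::finite \<times> 'b::finite \<times> 'e::finite)^('a \<times> 'b \<times> 'e) \<Rightarrow> complex^('a \<times> 'b)^('a \<times> 'b)" where
  "ABE_tr_E X = (\<chi> p q. \<Sum>k\<in>UNIV. X $ (fst p, snd p, k) $ (fst q, snd q, k))"

definition ABE_tr_B ::
    "complex^('a::finite \<times> 'b::finite \<times> 'e::finite)^('a \<times> 'b \<times> 'e) \<Rightarrow> complex^('a \<times> 'e)^('a \<times> 'e)" where
  "ABE_tr_B X = (\<chi> p q. \<Sum>i\<in>UNIV. X $ (fst p, i, snd p) $ (fst q, i, snd q))"

text \<open>\<^term>\<open>linear\<close> is real linearity; maps on operators have to be complex linear.\<close>

definition superop_linear :: "(complex^'m^'m \<Rightarrow> complex^'n^'n) \<Rightarrow> bool" where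
  "superop_linear T \<longleftrightarrow>
    (\<forall>X Y. T (X + Y) = T X + T Y) \<and> (\<forall>c X. T (map_matrix ((*) c) X) = map_matrix ((*) c) (T X))"

definition trace_preserving :: "(complex^'m^'m \<Rightarrow> complex^'n^'n) \<Rightarrow> bool" where
  "trace_preserving T \<longleftrightarrow> (\<forall>X. trace (T X) = trace X)"

text \<open>An operator on \<open>\<complex>\<^sup>k \<otimes> H\<close> is a \<open>k \<times> k\<close> block matrix \<open>(X i j)\<close>, \<open>i, j < k\<close>, of operators on \<open>H\<close>,
  and a vector of \<open>\<complex>\<^sup>k \<otimes> H\<close> is a family \<open>(v i)\<close>, \<open>i < k\<close>; the sum below is \<open>\<langle>v, X v\<rangle>\<close>.
  Blocks are used because \<open>k\<close> is quantified in the definition of complete positivity and so cannot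
  be the cardinality of an index type.\<close>

definition block_positive :: "nat \<Rightarrow> (nat \<Rightarrow> nat \<Rightarrow> complex^'m^'m) \<Rightarrow> bool" where
  "block_positive k X \<longleftrightarrow>
    (\<forall>v :: nat \<Rightarrow> complex^'m. (\<Sum>i<k. \<Sum>j<k. cdot (v i) (X i j *v v j)) \<in> \<real>\<^sub>\<ge>\<^sub>0)"

text \<open>Applying \<open>T\<close> to each block is \<open>id\<^sub>k \<otimes> T\<close>.\<close>

definition completely_positive :: "(complex^'m^'m \<Rightarrow> complex^'n^'n) \<Rightarrow> bool" where
  "completely_positive T \<longleftrightarrow>
    (\<forall>k X. block_positive k X \<longrightarrow> block_positive k (\<lambda>i j. T (X i j)))"

definition quantum_channel :: "(complex^'m^'m \<Rightarrow> complex^'n^'n) \<Rightarrow> bool" where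
  "quantum_channel T \<longleftrightarrow> superop_linear T \<and> completely_positive T \<and> trace_preserving T"

definition E_to_B_degradable :: "complex^('a::finite \<times> 'b::finite \<times> 'e::finite) \<Rightarrow> bool" where
  "E_to_B_degradable \<psi> \<longleftrightarrow>
    (\<exists>(r::nat) (F :: nat \<Rightarrow> complex^'e^'b).
      (\<Sum>j=1..r. adj (F j) ** F j) = mat 1 \<and>
      (\<Sum>j=1..r. ((mat 1 :: complex^'a^'a) \<otimes>\<^sub>m F j) ** ABE_tr_B (ketbra \<psi> \<psi>) **
          adj ((mat 1 :: complex^'a^'a) \<otimes>\<^sub>m F j))
        = ABE_tr_E (ketbra \<psi> \<psi>))"

definition channel_B ::
    "complex^('b::finite \<times> 'e::finite)^('b \<times> 'e) \<Rightarrow> complex^'e \<Rightarrow> complex^'b^'b \<Rightarrow> complex^'b^'b" where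
  "channel_B U e\<^sub>0 \<rho> = BE_tr_E (U ** (\<rho> \<otimes>\<^sub>m ketbra e\<^sub>0 e\<^sub>0) ** adj U)"

definition channel_E ::
    "complex^('b::finite \<times> 'e::finite)^('b \<times> 'e) \<Rightarrow> complex^'e \<Rightarrow> complex^'b^'b \<Rightarrow> complex^'e^'e" where
  "channel_E U e\<^sub>0 \<rho> = BE_tr_B (U ** (\<rho> \<otimes>\<^sub>m ketbra e\<^sub>0 e\<^sub>0) ** adj U)"

definition anti_degradable_wrt ::
    "(complex^'b^'b \<Rightarrow> complex^'b^'b) \<Rightarrow> (complex^'b^'b \<Rightarrow> complex^'e^'e) \<Rightarrow> bool" where
  "anti_degradable_wrt \<Phi>\<^sub>B \<Phi>\<^sub>E \<longleftrightarrow>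
    (\<exists>T :: complex^'e^'e \<Rightarrow> complex^'b^'b. quantum_channel T \<and> T \<circ> \<Phi>\<^sub>E = \<Phi>\<^sub>B)"

text \<open>The unnormalized maximally entangled vector of the bases \<open>a\<close> and \<open>b\<close>.\<close>

definition max_entangled :: "('n \<Rightarrow> complex^'n) \<Rightarrow> ('n \<Rightarrow> complex^'n) \<Rightarrow> complex^('n \<times> 'n)" where
  "max_entangled a b = (\<Sum>i\<in>UNIV. a i \<otimes>\<^sub>v b i)"

end

theory Submission imports Defs begin

text \<open>
  Write \<open>c\<^sub>x = \<Sum>\<^sub>i \<langle>x|a\<^sub>i\<rangle> b\<^sub>i\<close> for the slices of the maximally entangled vector. The \<open>(x, y)\<close> block,
  with respect to \<open>H\<^sub>A\<close>, of the degradability identity is \<open>T (\<Phi>\<^sub>E |c\<^sub>x\<rangle>\<langle>c\<^sub>y|) = \<Phi>\<^sub>B |c\<^sub>x\<rangle>\<langle>c\<^sub>y|\<close>, where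
  \<open>T\<close> has the Kraus operators \<open>F\<^sub>j\<close>. Since \<open>a\<close> and \<open>b\<close> are orthonormal bases, \<open>\<Sum>\<^sub>x |c\<^sub>x\<rangle>\<langle>c\<^sub>x| = I\<close>, so the
  operators \<open>|c\<^sub>x\<rangle>\<langle>c\<^sub>y|\<close> span, and the identity extends to all operators by linearity.
\<close>

section \<open>Adjoints and rank-one operators\<close>

lemma adj_nth [simp]: "adj A $ i $ j = cnj (A $ j $ i)"
  by (simp add: adj_def map_matrix_def transpose_def)

lemma ketbra_nth [simp]: "ketbra u v $ i $ j = u $ i * cnj (v $ j)"
  by (simp add: ketbra_def)

lemma tensor_vec_nth [simp]: "(u \<otimes>\<^sub>v v) $ (i, j) = u $ i * v $ j"
  by (simp add: tensor_vec_def)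

lemma tensor_mat_nth [simp]: "(A \<otimes>\<^sub>m B) $ (i, k) $ (j, l) = A $ i $ j * B $ k $ l"
  by (simp add: tensor_mat_def)

lemma scale_matrix_nth [simp]: "map_matrix ((*) c) A $ i $ j = c * A $ i $ j"
  by (simp add: map_matrix_def)

lemma UNIV_prod_sum:
  fixes f :: "'a::finite \<times> 'b::finite \<Rightarrow> 'c::comm_monoid_add"
  shows "(\<Sum>p\<in>UNIV. f p) = (\<Sum>i\<in>UNIV. \<Sum>j\<in>UNIV. f (i, j))"
  by (simp add: sum.cartesian_product UNIV_Times_UNIV[symmetric] del: UNIV_Times_UNIV)

lemma ketbra_mult_vec:
  fixes A :: "complex^'m::finite^'n::finite" and B :: "complex^'p::finite^'q::finite"
  shows "ketbra (A *v u) (B *v v) = A ** ketbra u v ** adj B"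
  by (simp add: vec_eq_iff matrix_vector_mult_def matrix_matrix_mult_def sum_product sum_distrib_left
      sum_distrib_right mult_ac)

lemma ketbra_tensor_vec:
  "ketbra (u \<otimes>\<^sub>v u') (v \<otimes>\<^sub>v v') = ketbra u v \<otimes>\<^sub>m ketbra u' v'"
  by (simp add: vec_eq_iff)

lemma cdot_matrix_mult:
  fixes A :: "complex^'m::finite^'n::finite"
  shows "cdot u (A *v v) = cdot (adj A *v u) v"
  by (simp add: cdot_def matrix_vector_mult_def sum_distrib_left sum_distrib_right mult_ac)
    (rule sum.swap)

lemma cdot_sum_right: "cdot u (\<Sum>i\<in>S. f i) = (\<Sum>i\<in>S. cdot u (f i))"
  by (simp add: cdot_def sum_distrib_left) (rule sum.swap)

lemma sum_matrix_vector_mult: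
  fixes A :: "'i \<Rightarrow> complex^'m::finite^'n::finite"
  shows "(\<Sum>i\<in>S. A i) *v v = (\<Sum>i\<in>S. A i *v v)"
  by (induction S rule: infinite_finite_induct) (simp_all add: matrix_vector_mult_add_rdistrib)

lemma matrix_mult_add_left:
  fixes A B :: "complex^'m::finite^'n::finite"
  shows "(A + B) ** C = A ** C + B ** C"
  by (simp add: vec_eq_iff matrix_matrix_mult_def algebra_simps sum.distrib)

lemma sum_matrix_mult:
  fixes A :: "'i \<Rightarrow> complex^'m::finite^'n::finite" and X :: "complex^'p::finite^'m"
  shows "(\<Sum>i\<in>S. A i) ** X = (\<Sum>i\<in>S. A i ** X)"
  by (induction S rule: infinite_finite_induct) (simp_all add: matrix_mult_add_left)

lemma matrix_mult_sum:
  fixes A :: "'i \<Rightarrow> complex^'p::finite^'m::finite" and X :: "complex^'m^'n::finite"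
  shows "X ** (\<Sum>i\<in>S. A i) = (\<Sum>i\<in>S. X ** A i)"
  by (induction S rule: infinite_finite_induct) (simp_all add: matrix_add_ldistrib)

lemma trace_sum:
  fixes A :: "'i \<Rightarrow> complex^'n::finite^'n"
  shows "trace (\<Sum>i\<in>S. A i) = (\<Sum>i\<in>S. trace (A i))"
  by (simp add: trace_def) (rule sum.swap)

text \<open>The middle factors \<open>u'\<close>, \<open>X\<close>, \<open>v\<close> contract to a
  scalar. This supplies the coefficients when an operator is expanded between two resolutions of the
  identity.\<close>

lemma ketbra_mult_ketbra:
  fixes X :: "complex^'n::finite^'m::finite"
  shows "ketbra u u' ** X ** ketbra v v' = map_matrix ((*) (cdot u' (X *v v))) (ketbra u v')"
  by (simp add: vec_eq_iff matrix_matrix_mult_def matrix_vector_mult_def cdot_def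
      sum_distrib_left sum_distrib_right mult_ac) (auto intro: sum.swap)

section \<open>Linear maps on operators\<close>

lemma superop_linear_sum:
  assumes "superop_linear T"
  shows "T (\<Sum>i\<in>S. f i) = (\<Sum>i\<in>S. T (f i))"
proof -
  \<comment> \<open>Additivity at \<open>0 + 0\<close>. It settles the empty sum and also an
    infinite \<open>S\<close>, where the sum is 0 by convention.\<close>
  have "T 0 = 0"
    using assms unfolding superop_linear_def by (metis add_cancel_right_right)
  then show ?thesis
    using assms unfolding superop_linear_def
    by (induction S rule: infinite_finite_induct) simp_all
qed

lemma superop_linear_comp:
  assumes "superop_linear S" "superop_linear T"
  shows "superop_linear (S \<circ> T)"
  using assms by (simp add: superop_linear_def)

text \<open>Multiplying \<open>X\<close> on both sides by the resolution of the identity writes it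
  as a combination of the operators \<open>ketbra (c x) (c y)\<close>, with coefficients
  \<open>cdot (c x) (X *v c y)\<close>. Linear maps that agree on these operators therefore agree at
  \<open>X\<close>.\<close>

lemma superop_linear_eqI:
  fixes S T :: "complex^'m::finite^'m \<Rightarrow> complex^'n::finite^'n" and c :: "'i::finite \<Rightarrow> complex^'m"
  assumes "superop_linear S" "superop_linear T"
    and resolution: "(\<Sum>x\<in>UNIV. ketbra (c x) (c x)) = mat 1"
    and eq: "\<And>x y. S (ketbra (c x) (c y)) = T (ketbra (c x) (c y))"
  shows "S = T"
proof
  fix X
  let ?t = "\<lambda>x y. map_matrix ((*) (cdot (c x) (X *v c y))) (ketbra (c x) (c y))"
  have "X = (\<Sum>x\<in>UNIV. ketbra (c x) (c x)) ** X ** (\<Sum>x\<in>UNIV. ketbra (c x) (c x))"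
    by (simp add: resolution)
  then have "X = (\<Sum>y\<in>UNIV. \<Sum>x\<in>UNIV. ?t x y)"
    by (simp add: sum_matrix_mult matrix_mult_sum ketbra_mult_ketbra)
  moreover have "S (?t x y) = T (?t x y)" for x y
    using assms(1,2) eq unfolding superop_linear_def by metis
  ultimately show "S X = T X"
    by (metis (mono_tags, lifting) superop_linear_sum[OF assms(1)] superop_linear_sum[OF assms(2)] sum.cong)
qed

section \<open>Kraus maps as quantum channels\<close>

definition kraus_map ::
    "'i set \<Rightarrow> ('i \<Rightarrow> complex^'m::finite^'n::finite) \<Rightarrow> complex^'m^'m \<Rightarrow> complex^'n^'n" where
  "kraus_map S F X = (\<Sum>j\<in>S. F j ** X ** adj (F j))"

lemma scale_matrix_mult_left:
  fixes A :: "complex^'m::finite^'n::finite"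
  shows "map_matrix ((*) c) A ** B = map_matrix ((*) c) (A ** B)"
  by (simp add: vec_eq_iff matrix_matrix_mult_def sum_distrib_left mult_ac)

lemma scale_matrix_mult_right:
  fixes A :: "complex^'m::finite^'n::finite"
  shows "A ** map_matrix ((*) c) B = map_matrix ((*) c) (A ** B)"
  by (simp add: vec_eq_iff matrix_matrix_mult_def sum_distrib_left mult_ac)

lemma superop_linear_kraus_map: "superop_linear (kraus_map S F)"
proof -
  have "kraus_map S F (map_matrix ((*) c) X) = map_matrix ((*) c) (kraus_map S F X)" for c X
    unfolding kraus_map_def
    by (simp add: scale_matrix_mult_left scale_matrix_mult_right)
      (simp add: vec_eq_iff sum_distrib_left)
  then show ?thesis
    by (simp add: superop_linear_def kraus_map_def matrix_add_ldistrib matrix_mult_add_left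
        sum.distrib)
qed

text \<open>Moving each \<open>F n\<close> to the other side of the inner product turns the
  quadratic form of the image at \<open>v\<close> into a sum over \<open>n\<close> of the quadratic
  forms of \<open>X\<close> at the families \<open>adj (F n) *v v i\<close>, each nonnegative by
  block positivity of \<open>X\<close>.\<close>

lemma completely_positive_kraus_map:
  fixes F :: "'i \<Rightarrow> complex^'b::finite^'c::finite"
  shows "completely_positive (kraus_map S F)"
  unfolding completely_positive_def
proof (intro allI impI)
  fix k and X :: "nat \<Rightarrow> nat \<Rightarrow> complex^'b^'b"
  assume X: "block_positive k X"
  have nonneg: "(\<Sum>n\<in>S. f n) \<in> \<real>\<^sub>\<ge>\<^sub>0" if "\<And>n. f n \<in> \<real>\<^sub>\<ge>\<^sub>0" for f :: "_ \<Rightarrow> complex"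
    using that by (induction S rule: infinite_finite_induct) auto
  show "block_positive k (\<lambda>i j. kraus_map S F (X i j))"
    unfolding block_positive_def
  proof
    fix v
    have "(\<Sum>i<k. \<Sum>j<k. cdot (v i) (kraus_map S F (X i j) *v v j)) =
        (\<Sum>i<k. \<Sum>j<k. \<Sum>n\<in>S. cdot (adj (F n) *v v i) (X i j *v (adj (F n) *v v j)))"
      by (simp add: kraus_map_def sum_matrix_vector_mult cdot_sum_right cdot_matrix_mult[symmetric]
          matrix_vector_mul_assoc matrix_mul_assoc)
    also have "\<dots> = (\<Sum>n\<in>S. \<Sum>i<k. \<Sum>j<k. cdot (adj (F n) *v v i) (X i j *v (adj (F n) *v v j)))"
      by (simp add: sum.swap[of _ S])
    also have "\<dots> \<in> \<real>\<^sub>\<ge>\<^sub>0"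
      using X by (intro nonneg) (simp add: block_positive_def)
    finally show "(\<Sum>i<k. \<Sum>j<k. cdot (v i) (kraus_map S F (X i j) *v v j)) \<in> \<real>\<^sub>\<ge>\<^sub>0" .
  qed
qed

text \<open>Cyclicity of the trace brings \<open>adj (F j)\<close> next to \<open>F j\<close>, and
  the sum over \<open>j\<close> then collapses to the identity.\<close>

lemma trace_preserving_kraus_map:
  assumes "(\<Sum>j\<in>S. adj (F j) ** F j) = mat 1"
  shows "trace_preserving (kraus_map S F)"
  unfolding trace_preserving_def
proof
  fix X
  have "trace (kraus_map S F X) = (\<Sum>j\<in>S. trace (adj (F j) ** F j ** X))"
    unfolding kraus_map_def trace_sum
    by (metis trace_mul_sym matrix_mul_assoc)
  also have "\<dots> = trace X"
    by (simp add: assms flip: trace_sum sum_matrix_mult)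
  finally show "trace (kraus_map S F X) = trace X" .
qed

lemma quantum_channel_kraus_map:
  assumes "(\<Sum>j\<in>S. adj (F j) ** F j) = mat 1"
  shows "quantum_channel (kraus_map S F)"
  using assms by (simp add: quantum_channel_def superop_linear_kraus_map
      completely_positive_kraus_map trace_preserving_kraus_map)

section \<open>Complex linearity of the channel and its complement\<close>

lemma tensor_mat_add_left: "(A + B) \<otimes>\<^sub>m C = A \<otimes>\<^sub>m C + B \<otimes>\<^sub>m C"
  by (simp add: vec_eq_iff algebra_simps)

lemma tensor_mat_scale_left: "map_matrix ((*) c) A \<otimes>\<^sub>m C = map_matrix ((*) c) (A \<otimes>\<^sub>m C)"
  by (simp add: vec_eq_iff)

lemma superop_linear_channel_B: "superop_linear (channel_B U e)"
  unfolding superop_linear_def channel_B_def tensor_mat_add_left tensor_mat_scale_left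
    matrix_add_ldistrib matrix_mult_add_left scale_matrix_mult_left scale_matrix_mult_right
  by (simp add: BE_tr_E_def vec_eq_iff sum.distrib sum_distrib_left)

lemma superop_linear_channel_E: "superop_linear (channel_E U e)"
  unfolding superop_linear_def channel_E_def tensor_mat_add_left tensor_mat_scale_left
    matrix_add_ldistrib matrix_mult_add_left scale_matrix_mult_left scale_matrix_mult_right
  by (simp add: BE_tr_B_def vec_eq_iff sum.distrib sum_distrib_left)

section \<open>Blocks with respect to the first tensor factor\<close>

text \<open>The partial inner product of \<open>v\<close> with a vector of the standard basis of the
  first factor; the basis \<open>a\<close> of the theorem plays no part in the slicing.\<close>

definition slice :: "complex^('a::finite \<times> 'm::finite) \<Rightarrow> 'a \<Rightarrow> complex^'m" where
  "slice v x = (\<chi> i. v $ (x, i))"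

definition block ::
    "complex^('a::finite \<times> 'm::finite)^('a \<times> 'm) \<Rightarrow> 'a \<Rightarrow> 'a \<Rightarrow> complex^'m^'m" where
  "block X x y = (\<chi> i j. X $ (x, i) $ (y, j))"

lemma slice_tensor_mult:
  "slice ((mat 1 \<otimes>\<^sub>m U) *v v) x = U *v slice v x"
  by (simp add: slice_def vec_eq_iff matrix_vector_mult_def UNIV_prod_sum mat_def if_distrib
      if_distribR sum.If_cases flip: sum_distrib_left)

lemma slice_assoc_tensor: "slice (assoc_vec (v \<otimes>\<^sub>v e)) x = slice v x \<otimes>\<^sub>v e"
  by (simp add: slice_def assoc_vec_def vec_eq_iff)

lemma block_sum: "block (\<Sum>j\<in>S. X j) x y = (\<Sum>j\<in>S. block (X j) x y)"
  by (simp add: block_def vec_eq_iff)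

text \<open>The factor \<open>mat 1\<close> is diagonal in the first index, so multiplication from
  the left keeps the block row \<open>x\<close> and multiplication from the right keeps the block
  column \<open>y\<close>.\<close>

lemma block_conj:
  fixes F :: "complex^'m::finite^'n::finite"
  shows "block ((mat 1 \<otimes>\<^sub>m F) ** X ** adj (mat 1 \<otimes>\<^sub>m F)) x y = F ** block X x y ** adj F"
proof -
  have left: "((mat 1 \<otimes>\<^sub>m F) ** Y) $ (x, i) $ q = (\<Sum>k\<in>UNIV. F $ i $ k * Y $ (x, k) $ q)"
    for Y :: "complex^'q::finite^_" and i q
    by (simp add: matrix_matrix_mult_def UNIV_prod_sum mat_def if_distrib if_distribR sum.If_cases
        cong: if_cong)
  have right: "(Y ** adj (mat 1 \<otimes>\<^sub>m F)) $ p $ (y, j) = (\<Sum>k\<in>UNIV. Y $ p $ (y, k) * cnj (F $ j $ k))"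
    for Y :: "complex^_^'p::finite" and j p
    by (simp add: matrix_matrix_mult_def UNIV_prod_sum mat_def if_distrib if_distribR sum.If_cases
        cong: if_cong)
  show ?thesis
    by (simp add: vec_eq_iff block_def left right) (simp add: matrix_matrix_mult_def)
qed

text \<open>A partial trace over B or E leaves the A indices alone, so it commutes with taking
  blocks.\<close>

lemma block_ABE_tr_B:
  "block (ABE_tr_B (ketbra \<psi> \<psi>)) x y = BE_tr_B (ketbra (slice \<psi> x) (slice \<psi> y))"
  by (simp add: block_def ABE_tr_B_def BE_tr_B_def slice_def vec_eq_iff)

lemma block_ABE_tr_E:
  "block (ABE_tr_E (ketbra \<psi> \<psi>)) x y = BE_tr_E (ketbra (slice \<psi> x) (slice \<psi> y))"
  by (simp add: block_def ABE_tr_E_def BE_tr_E_def slice_def vec_eq_iff)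

section \<open>Slices of the maximally entangled vector\<close>

lemma slice_max_entangled: "slice (max_entangled a b) x $ k = (\<Sum>i\<in>UNIV. a i $ x * b i $ k)"
  by (simp add: slice_def max_entangled_def)

text \<open>With the \<open>b i\<close> as columns of a square matrix \<open>B\<close>,
  orthonormality says that \<open>adj B\<close> is a left inverse, hence a right inverse; the latter
  is completeness.\<close>

lemma orthonormal_basis_complete:
  fixes b :: "'n::finite \<Rightarrow> complex^'n"
  assumes "orthonormal_basis b"
  shows "(\<Sum>i\<in>UNIV. ketbra (b i) (b i)) = mat 1"
proof -
  define B :: "complex^'n^'n" where "B = (\<chi> k i. b i $ k)"
  have "adj B ** B = mat 1"
    using assms
    by (simp add: B_def vec_eq_iff matrix_matrix_mult_def mat_def orthonormal_basis_def cdot_def)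
  then have "B ** adj B = mat 1"
    using matrix_left_right_inverse by blast
  then show ?thesis
    by (simp add: B_def vec_eq_iff matrix_matrix_mult_def)
qed

text \<open>Summing over \<open>x\<close> first produces the inner products
  \<open>cdot (a j) (a i)\<close>, which leave only the terms with \<open>i = j\<close>; what
  remains is the completeness relation of \<open>b\<close>.\<close>

lemma max_entangled_slices_complete:
  fixes a b :: "'n::finite \<Rightarrow> complex^'n"
  assumes "orthonormal_basis a" "orthonormal_basis b"
  shows "(\<Sum>x\<in>UNIV. ketbra (slice (max_entangled a b) x) (slice (max_entangled a b) x)) = mat 1"
    (is "?S = _")
proof -
  have "?S $ k $ l = (\<Sum>i\<in>UNIV. ketbra (b i) (b i)) $ k $ l" for k l
  proof -
    have "?S $ k $ l = (\<Sum>x\<in>UNIV. \<Sum>i\<in>UNIV. \<Sum>j\<in>UNIV.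
        (b i $ k * cnj (b j $ l)) * (cnj (a j $ x) * a i $ x))"
      by (simp add: slice_max_entangled sum_product mult_ac)
    also have "\<dots> = (\<Sum>i\<in>UNIV. \<Sum>j\<in>UNIV. \<Sum>x\<in>UNIV.
        (b i $ k * cnj (b j $ l)) * (cnj (a j $ x) * a i $ x))"
      by (subst sum.swap, subst (2) sum.swap) rule
    also have "\<dots> = (\<Sum>i\<in>UNIV. \<Sum>j\<in>UNIV. (b i $ k * cnj (b j $ l)) * cdot (a j) (a i))"
      by (simp add: cdot_def sum_distrib_left)
    also have "\<dots> = (\<Sum>i\<in>UNIV. \<Sum>j\<in>UNIV. if j = i then b i $ k * cnj (b j $ l) else 0)"
      using assms(1) by (intro sum.cong) (auto simp: orthonormal_basis_def)
    also have "\<dots> = (\<Sum>i\<in>UNIV. b i $ k * cnj (b i $ l))"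
      by simp
    finally show ?thesis by simp
  qed
  then show ?thesis
    by (simp add: vec_eq_iff orthonormal_basis_complete[OF assms(2), symmetric])
qed

theorem corollary5p2:
  fixes a b :: "'n::finite \<Rightarrow> complex^'n"
    and e\<^sub>0 :: "complex^'e::finite"
    and U :: "complex^('n \<times> 'e)^('n \<times> 'e)"
  assumes "orthonormal_basis a"
    and "orthonormal_basis b"
    and "norm e\<^sub>0 = 1"
    and "unitary U"
    and "E_to_B_degradable
           (((mat 1 :: complex^'n^'n) \<otimes>\<^sub>m U) *v assoc_vec (max_entangled a b \<otimes>\<^sub>v e\<^sub>0))"
  shows "anti_degradable_wrt (channel_B U e\<^sub>0) (channel_E U e\<^sub>0)"
proof -
  define c where "c = slice (max_entangled a b)"
  define \<psi> where "\<psi> = ((mat 1 :: complex^'n^'n) \<otimes>\<^sub>m U) *v assoc_vec (max_entangled a b \<otimes>\<^sub>v e\<^sub>0)"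
  obtain r and F :: "nat \<Rightarrow> complex^'e^'n" where
    F: "(\<Sum>j=1..r. adj (F j) ** F j) = mat 1" and
    deg: "(\<Sum>j=1..r. ((mat 1 :: complex^'n^'n) \<otimes>\<^sub>m F j) ** ABE_tr_B (ketbra \<psi> \<psi>) **
          adj ((mat 1 :: complex^'n^'n) \<otimes>\<^sub>m F j)) = ABE_tr_E (ketbra \<psi> \<psi>)"
    using assms(5) unfolding E_to_B_degradable_def \<psi>_def by blast
  define T where "T = kraus_map {1..r} F"
  \<comment> \<open>The slice of the output vector at \<open>x\<close> is \<open>U\<close> applied
    to the tensor product of \<open>c x\<close> and \<open>e\<^sub>0\<close>. The right-hand side is
    the operator whose partial traces define both channels at
    \<open>ketbra (c x) (c y)\<close>.\<close>
  have ket: "ketbra (slice \<psi> x) (slice \<psi> y) = U ** (ketbra (c x) (c y) \<otimes>\<^sub>m ketbra e\<^sub>0 e\<^sub>0) ** adj U"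
    for x y
    by (simp add: \<psi>_def c_def slice_tensor_mult slice_assoc_tensor ketbra_mult_vec ketbra_tensor_vec)
  have "T (channel_E U e\<^sub>0 (ketbra (c x) (c y))) = channel_B U e\<^sub>0 (ketbra (c x) (c y))" for x y
    using arg_cong[OF deg, of "\<lambda>X. block X x y"]
    by (simp add: block_sum block_conj block_ABE_tr_B block_ABE_tr_E ket T_def kraus_map_def
        channel_B_def channel_E_def)
  then have "T \<circ> channel_E U e\<^sub>0 = channel_B U e\<^sub>0"
    using max_entangled_slices_complete[OF assms(1,2)]
    by (intro superop_linear_eqI[where c = c] superop_linear_comp superop_linear_channel_B
        superop_linear_channel_E) (simp_all add: T_def superop_linear_kraus_map c_def)
  moreover have "quantum_channel T"
    using F by (simp add: T_def quantum_channel_kraus_map)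
  ultimately show ?thesis
    unfolding anti_degradable_wrt_def by blast
qed

end
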